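(* Let $N=|X\setminus A|$. For every $t>0$ and every $f\in\mathcal H_t$, $$\mathrm{Lip}(f)\;\le\;\|f\|_{\mathcal H_t}\left(\int_{\mathbb T^{N}}\mathrm{Lip}(\chi_\theta)^2\,e^{-t\lambda(\theta)}\,d\mu(\theta)\right)^{1/2},$$ and the function $$t\longmapsto\int_{\mathbb T^{N}}\mathrm{Lip}(\chi_\theta)^2\,e^{-t\lambda(\theta)}\,d\mu(\theta)$$ is finite and nonincreasing on $(0,\infty)$.
   Context: Lipschitz seminorm: for a map $f:(M_1,\rho_1)\to(M_2,\rho_2)$ of metric spaces, $\mathrm{Lip}(f):=\sup_{\alpha\ne\beta}\rho_2(f(\alpha),f(\beta))/\rho_1(\alpha,\beta)\in[0,\infty]$. Setting: $(X,d)$ is a metric space and $A\subseteq X$ is nonempty with $X\setminus A=\{x_1,\dots,x_N\}$ finite, $N\ge1$. Write $d(x,A)=\inf_{a\in A}d(x,a)$ and $d_1(x,y):=\min\{d(x,y),\,d(x,A)+d(y,A)\}$. Let $X/A=\{[A],x_1,\dots,x_N\}$ be the quotient collapsing $A$ to the basepoint $[A]$, and let $\overline d_1$ be the function on $X/A$ induced by $d_1$; it is assumed to be a metric on $X/A$ (equivalently $d(x_j,A)>0$ for all $j$). Diagrams: $D(X,A)$ is the free commutative monoid on $X\setminus A$ (finite multisets of points of $X\setminus A$; the point $[A]$ is identified with $0$). For $\alpha,\beta\in D(X,A)$, $W_1(\alpha,\beta)$ is the infimum of $\sum_{i}\overline d_1(u_i,v_i)$ over all finite multisets $\{(u_i,v_i)\}_i$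 of pairs in $(X/A)\times(X/A)$ such that $\sum_i u_i$ equals $\alpha$ and $\sum_i v_i$ equals $\beta$ modulo multiples of $[A]$. $K(X,A)$ is the Grothendieck group of $D(X,A)$, identified with the free abelian group $\mathbb Z^{N}$ with basis $e_1,\dots,e_N$, where $e_j$ is the class of $x_j$. It carries the translation-invariant metric $\rho(a-b,c-e):=W_1(a+e,c+b)$ for $a,b,c,e\in D(X,A)$. Characters and phases: $\mathbb T^{N}=\mathbb R^{N}/2\pi\mathbb Z^{N}$ with normalized Haar (Lebesgue) probability measure $\mu$. For $\theta\in\mathbb T^N$, $\chi_\theta:K(X,A)\to S^1\subset\mathbb C$ is $\chi_\theta(\sum_j n_je_j)=\exp(i\sum_j n_j\theta_j)$. The phase function $\phi_\theta:X/A\to S^1$ is $\phi_\theta([A])=1$, $\phi_\theta(x_j)=e^{i\theta_j}$. $S^1$ carries the geodesic (shorter arc length) metric $\operatorname{dist}(e^{ia},e^{ib})=\inf_{k\in\mathbb Z}|a-b+2\pi k|$. $\mathrm{Lip}(\chi_\theta)$ is taken with respect to $\rho$ and $\operatorname{dist}$. Graph model: fix a connected (simple, undirected) graph $H=(V,E)$ with $V=X/A$ such that, when each edge $\{u,v\}$ is given length $\overline d_1(u,v)$, the shortest-path metric of $H$ is $\overline d_1$. Fix symmetric conductances $w_{uv}=w_{vu}>0$ for $\{u,v\}\in E$ (not necessarily equal to the lengths), with $w_{uv}=0$ if $\{u,v\}\notin E$. The Dirichlet energy is $\lambda(\theta):=\tfrac12\sum_{u,v\in V}w_{uv}|\phi_\theta(u)-\phi_\theta(v)|^2$,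 with $|\cdot|$ the complex modulus. Heat RKHS: for $t>0$, $\nu_t$ is the measure $d\nu_t(\theta)=e^{-t\lambda(\theta)}d\mu(\theta)$ on $\mathbb T^N$, and $k_t(\alpha,\beta)=\int_{\mathbb T^N}\chi_\theta(\alpha-\beta)\,d\nu_t(\theta)$ for $\alpha,\beta\in K(X,A)$, a positive definite kernel. $\mathcal H_t$ is the reproducing kernel Hilbert space of complex-valued functions on $K(X,A)$ with kernel $k_t$ (so $f(\alpha)=\langle f,k_t(\cdot,\alpha)\rangle_{\mathcal H_t}$). For $f\in\mathcal H_t$, $\mathrm{Lip}(f)$ is taken with respect to $\rho$ and the usual metric on $\mathbb C$. *)

theory Defs
  imports
    "HOL-Probability.Probability"
    "HOL-Library.Poly_Mapping"
    "HOL-Library.Multiset"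
    "Graph_Theory.Digraph_Component"
    "Graph_Theory.Pair_Digraph"
    "Graph_Theory.Shortest_Path"
begin

text \<open>
  The ambient metric space \<open>X\<close> is a type of class \<^class>\<open>metric_space\<close>, so that \<open>X \ A\<close> is \<open>- A\<close> and
  \<open>d(x, A)\<close> is \<open>infdist x A\<close>.
\<close>

subsection \<open>Lipschitz seminorm\<close>

definition Lip :: "'b set \<Rightarrow> ('b \<Rightarrow> 'b \<Rightarrow> real) \<Rightarrow> ('c \<Rightarrow> 'c \<Rightarrow> real) \<Rightarrow> ('b \<Rightarrow> 'c) \<Rightarrow> ennreal"
  where "Lip M \<rho>1 \<rho>2 f =
    (SUP (\<alpha>, \<beta>) \<in> {(\<alpha>, \<beta>). \<alpha> \<in> M \<and> \<beta> \<in> M \<and> \<alpha> \<noteq> \<beta>}. ennreal (\<rho>2 (f \<alpha>) (f \<beta>)) / ennreal (\<rho>1 \<alpha> \<beta>))"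


subsection \<open>The quotient \<open>X/A\<close>\<close>

definition d1 :: "'a::metric_space set \<Rightarrow> 'a \<Rightarrow> 'a \<Rightarrow> real"
  where "d1 A x y = min (dist x y) (infdist x A + infdist y A)"

text \<open>\<open>None\<close> is the basepoint \<open>[A]\<close>, and \<open>Some x\<close> is the class of a point \<open>x \<notin> A\<close>.\<close>

definition quot_pts :: "'a set \<Rightarrow> 'a option set"
  where "quot_pts A = insert None (Some ` (- A))"

definition quot_rep :: "'a set \<Rightarrow> 'a option \<Rightarrow> 'a"
  where "quot_rep A u = (case u of None \<Rightarrow> SOME a. a \<in> A | Some x \<Rightarrow> x)"

text \<open>The choice of representative is immaterial, see \<open>d1bar_proj\<close> below.\<close>

definition d1bar :: "'a::metric_space set \<Rightarrow> 'a option \<Rightarrow> 'a option \<Rightarrow> real"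
  where "d1bar A u v = d1 A (quot_rep A u) (quot_rep A v)"

definition quot_proj :: "'a set \<Rightarrow> 'a \<Rightarrow> 'a option"
  where "quot_proj A x = (if x \<in> A then None else Some x)"

lemma d1_base_eq:
  assumes "a \<in> A" "b \<in> A"
  shows "d1 A a x = d1 A b x" "d1 A x a = d1 A x b"
proof -
  have *: "d1 A c x = infdist x A" "d1 A x c = infdist x A" if "c \<in> A" for c
    using infdist_le[OF that, of x] that by (auto simp: d1_def dist_commute)
  show "d1 A a x = d1 A b x" "d1 A x a = d1 A x b"
    using *[OF assms(1)] *[OF assms(2)] by auto
qed

lemma d1bar_proj: "d1bar A (quot_proj A x) (quot_proj A y) = d1 A x y"
proof -
  have rep: "quot_rep A (quot_proj A x) \<in> A" if "x \<in> A" for x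
    unfolding quot_rep_def quot_proj_def using that someI[of "\<lambda>a. a \<in> A" x] by simp
  have rep': "quot_rep A (quot_proj A x) = x" if "x \<notin> A" for x
    using that by (simp add: quot_rep_def quot_proj_def)
  have 1: "d1 A (quot_rep A (quot_proj A x)) z = d1 A x z" for x z
    using d1_base_eq(1)[OF rep, of x x z] rep'[of x] by (cases "x \<in> A") simp_all
  have 2: "d1 A z (quot_rep A (quot_proj A x)) = d1 A z x" for x z
    using d1_base_eq(2)[OF rep, of x x z] rep'[of x] by (cases "x \<in> A") simp_all
  show ?thesis by (simp add: d1bar_def 1 2)
qed


subsection \<open>Diagrams and \<open>W\<^sub>1\<close>\<close>

definition diagrams :: "'a set \<Rightarrow> 'a multiset set"
  where "diagrams A = {\<alpha>. set_mset \<alpha> \<subseteq> - A}"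

text \<open>A point of \<open>X/A\<close> as a diagram; the basepoint is identified with \<open>0\<close>.\<close>

definition pt :: "'a option \<Rightarrow> 'a multiset"
  where "pt u = (case u of None \<Rightarrow> {#} | Some x \<Rightarrow> {#x#})"

definition matchings :: "'a set \<Rightarrow> 'a multiset \<Rightarrow> 'a multiset \<Rightarrow> ('a option \<times> 'a option) multiset set"
  where "matchings A \<alpha> \<beta> = {M. set_mset M \<subseteq> quot_pts A \<times> quot_pts A \<and>
    (\<Sum>(u, v)\<in>#M. pt u) = \<alpha> \<and> (\<Sum>(u, v)\<in>#M. pt v) = \<beta>}"

definition W1 :: "'a::metric_space set \<Rightarrow> 'a multiset \<Rightarrow> 'a multiset \<Rightarrow> real"
  where "W1 A \<alpha> \<beta> = (INF M\<in>matchings A \<alpha> \<beta>. \<Sum>(u, v)\<in>#M. d1bar A u v)"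


subsection \<open>The group \<open>K(X, A)\<close>\<close>

text \<open>
  The Grothendieck group of the diagrams is the free abelian group on \<open>X \ A\<close>: the formal integer
  combinations of points of \<open>X \ A\<close>, with \<^term>\<open>frag_of x\<close> the class \<open>e\<close> of the point \<open>x\<close>.
\<close>

definition K_group :: "'a set \<Rightarrow> ('a \<Rightarrow>\<^sub>0 int) set"
  where "K_group A = {g. Poly_Mapping.keys g \<subseteq> - A}"

definition K_class :: "'a multiset \<Rightarrow> ('a \<Rightarrow>\<^sub>0 int)"
  where "K_class \<alpha> = (\<Sum>x\<in>#\<alpha>. frag_of x)"

text \<open>The defining equation, and hence well-definedness, is \<open>K_dist_eq\<close> below.\<close>

definition K_dist :: "'a::metric_space set \<Rightarrow> ('a \<Rightarrow>\<^sub>0 int) \<Rightarrow> ('a \<Rightarrow>\<^sub>0 int) \<Rightarrow> real"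
  where "K_dist A g h = (THE r. \<exists>a\<in>diagrams A. \<exists>b\<in>diagrams A. \<exists>c\<in>diagrams A. \<exists>e\<in>diagrams A.
    g = K_class a - K_class b \<and> h = K_class c - K_class e \<and> r = W1 A (a + e) (c + b))"

lemma lookup_K_class: "Poly_Mapping.lookup (K_class \<alpha>) x = int (count \<alpha> x)"
  by (induction \<alpha>) (auto simp: K_class_def lookup_add)

lemma K_class_add: "K_class (\<alpha> + \<beta>) = K_class \<alpha> + K_class \<beta>"
  by (simp add: K_class_def)

lemma K_class_inject: "K_class \<alpha> = K_class \<beta> \<longleftrightarrow> \<alpha> = \<beta>"
  by (metis lookup_K_class multiset_eqI of_nat_eq_iff)

lemma matchings_cancel_point:
  assumes "Metric_space (quot_pts A) (d1bar A)"
    and M: "M \<in> matchings A (add_mset x \<alpha>) (add_mset x \<beta>)"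
  shows "\<exists>M'\<in>matchings A \<alpha> \<beta>. (\<Sum>(u, v)\<in>#M'. d1bar A u v) \<le> (\<Sum>(u, v)\<in>#M. d1bar A u v)"
proof -
  interpret Metric_space "quot_pts A" "d1bar A" by fact
  have sub: "set_mset M \<subseteq> quot_pts A \<times> quot_pts A"
    and su: "(\<Sum>(u, v)\<in>#M. pt u) = add_mset x \<alpha>" and sv: "(\<Sum>(u, v)\<in>#M. pt v) = add_mset x \<beta>"
    using M by (auto simp: matchings_def)
  have ex: "\<exists>p\<in>#N. h p = Some x" if "x \<in># (\<Sum>p\<in>#N. pt (h p))"
    for N :: "('a option \<times> 'a option) multiset" and h
    using that by (induction N) (auto simp: pt_def split: option.splits)
  have "(\<Sum>p\<in>#M. pt (fst p)) = add_mset x \<alpha>" "(\<Sum>p\<in>#M. pt (snd p)) = add_mset x \<beta>"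
    using su sv by (simp_all add: case_prod_unfold)
  then have "\<exists>p\<in>#M. fst p = Some x" and "\<exists>p\<in>#M. snd p = Some x"
    using ex[of fst M] ex[of snd M] by (simp_all only: union_single_eq_member)
  then obtain u v where v: "(Some x, v) \<in># M" and u: "(u, Some x) \<in># M"
    by auto
  show ?thesis
  proof (cases "(Some x, Some x) \<in># M")
    case True
    then obtain N where N: "M = add_mset (Some x, Some x) N"
      by (metis multi_member_split)
    have "N \<in> matchings A \<alpha> \<beta>"
      using sub su sv by (auto simp: matchings_def N pt_def)
    moreover have "(\<Sum>(u, v)\<in>#N. d1bar A u v) \<le> (\<Sum>(u, v)\<in>#M. d1bar A u v)"
      by (simp add: N)
    ultimately show ?thesis by blast
  next
    case False
    from v obtain N where N: "M = add_mset (Some x, v) N"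
      by (metis multi_member_split)
    have "(u, Some x) \<in># N" using u False N by auto
    with N obtain L where L: "M = add_mset (Some x, v) (add_mset (u, Some x) L)"
      by (metis multi_member_split)
    have "add_mset (u, v) L \<in> matchings A \<alpha> \<beta>"
      using sub su sv by (auto simp: matchings_def L pt_def)
    moreover have "d1bar A u v \<le> d1bar A u (Some x) + d1bar A (Some x) v"
      using sub by (intro triangle) (auto simp: L)
    hence "(\<Sum>(u, v)\<in>#add_mset (u, v) L. d1bar A u v) \<le> (\<Sum>(u, v)\<in>#M. d1bar A u v)"
      by (simp add: L)
    ultimately show ?thesis by blast
  qed
qed

lemma matchings_nonempty:
  assumes "\<alpha> \<in> diagrams A" "\<beta> \<in> diagrams A"
  shows "matchings A \<alpha> \<beta> \<noteq> {}"
proof -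
  let ?M = "image_mset (\<lambda>x. (Some x, None)) \<alpha> + image_mset (\<lambda>x. (None, Some x)) \<beta>"
  have "(\<Sum>(u, v)\<in>#?M. pt u) = \<alpha>" "(\<Sum>(u, v)\<in>#?M. pt v) = \<beta>"
    by (simp_all add: multiset.map_comp comp_def pt_def)
  moreover have "set_mset ?M \<subseteq> quot_pts A \<times> quot_pts A"
    using assms by (auto simp: diagrams_def quot_pts_def)
  ultimately have "?M \<in> matchings A \<alpha> \<beta>" by (simp add: matchings_def)
  thus ?thesis by blast
qed

lemma matchings_cost_bdd_below:
  assumes "Metric_space (quot_pts A) (d1bar A)"
  shows "bdd_below ((\<lambda>M. \<Sum>(u, v)\<in>#M. d1bar A u v) ` S)"
proof -
  interpret Metric_space "quot_pts A" "d1bar A" by fact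
  have "0 \<le> (\<Sum>(u, v)\<in>#M. d1bar A u v)" for M
    by (induction M) auto
  thus ?thesis by (intro bdd_belowI[of _ 0]) auto
qed

lemma W1_cancel_point:
  assumes met: "Metric_space (quot_pts A) (d1bar A)" and x: "x \<notin> A"
    and \<alpha>: "\<alpha> \<in> diagrams A" and \<beta>: "\<beta> \<in> diagrams A"
  shows "W1 A (add_mset x \<alpha>) (add_mset x \<beta>) = W1 A \<alpha> \<beta>"
proof (rule antisym)
  interpret Metric_space "quot_pts A" "d1bar A" by fact
  have ne: "matchings A \<alpha> \<beta> \<noteq> {}" "matchings A (add_mset x \<alpha>) (add_mset x \<beta>) \<noteq> {}"
    using x \<alpha> \<beta> by (simp_all add: matchings_nonempty diagrams_def)
  show "W1 A (add_mset x \<alpha>) (add_mset x \<beta>) \<le> W1 A \<alpha> \<beta>"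
    unfolding W1_def
  proof (rule cINF_mono[OF ne(1) matchings_cost_bdd_below[OF met]])
    fix M assume M: "M \<in> matchings A \<alpha> \<beta>"
    have "d1bar A (Some x) (Some x) = 0" using x by (simp add: quot_pts_def)
    moreover have "add_mset (Some x, Some x) M \<in> matchings A (add_mset x \<alpha>) (add_mset x \<beta>)"
      using M x by (auto simp: matchings_def pt_def quot_pts_def)
    ultimately show "\<exists>M'\<in>matchings A (add_mset x \<alpha>) (add_mset x \<beta>).
        (\<Sum>(u, v)\<in>#M'. d1bar A u v) \<le> (\<Sum>(u, v)\<in>#M. d1bar A u v)"
      by (intro bexI[of _ "add_mset (Some x, Some x) M"]) auto
  qed
  show "W1 A \<alpha> \<beta> \<le> W1 A (add_mset x \<alpha>) (add_mset x \<beta>)"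
    unfolding W1_def
    by (rule cINF_mono[OF ne(2) matchings_cost_bdd_below[OF met]]) (rule matchings_cancel_point[OF met])
qed

lemma W1_cancel:
  assumes met: "Metric_space (quot_pts A) (d1bar A)" and "\<gamma> \<in> diagrams A"
    and \<alpha>: "\<alpha> \<in> diagrams A" and \<beta>: "\<beta> \<in> diagrams A"
  shows "W1 A (\<alpha> + \<gamma>) (\<beta> + \<gamma>) = W1 A \<alpha> \<beta>"
  using assms(2)
proof (induction \<gamma>)
  case (add x \<gamma>)
  then have "x \<notin> A" "\<alpha> + \<gamma> \<in> diagrams A" "\<beta> + \<gamma> \<in> diagrams A" "\<gamma> \<in> diagrams A"
    using \<alpha> \<beta> by (auto simp: diagrams_def)
  with add.IH show ?case by (simp add: W1_cancel_point[OF met])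
qed simp

lemma K_dist_eq:
  assumes met: "Metric_space (quot_pts A) (d1bar A)"
    and D: "a \<in> diagrams A" "b \<in> diagrams A" "c \<in> diagrams A" "e \<in> diagrams A"
  shows "K_dist A (K_class a - K_class b) (K_class c - K_class e) = W1 A (a + e) (c + b)"
  unfolding K_dist_def
proof (rule the_equality)
  show "\<exists>a'\<in>diagrams A. \<exists>b'\<in>diagrams A. \<exists>c'\<in>diagrams A. \<exists>e'\<in>diagrams A.
      K_class a - K_class b = K_class a' - K_class b' \<and>
      K_class c - K_class e = K_class c' - K_class e' \<and> W1 A (a + e) (c + b) = W1 A (a' + e') (c' + b')"
    using D by blast
next
  fix r
  assume "\<exists>a'\<in>diagrams A. \<exists>b'\<in>diagrams A. \<exists>c'\<in>diagrams A. \<exists>e'\<in>diagrams A.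
      K_class a - K_class b = K_class a' - K_class b' \<and>
      K_class c - K_class e = K_class c' - K_class e' \<and> r = W1 A (a' + e') (c' + b')"
  then obtain a' b' c' e' where
    D': "a' \<in> diagrams A" "b' \<in> diagrams A" "c' \<in> diagrams A" "e' \<in> diagrams A"
    and eq: "K_class a - K_class b = K_class a' - K_class b'"
      "K_class c - K_class e = K_class c' - K_class e'"
    and r: "r = W1 A (a' + e') (c' + b')" by blast
  have "K_class (a + b') = K_class (a' + b)" "K_class (c + e') = K_class (c' + e)"
    using eq by (simp_all add: K_class_add algebra_simps)
  then have ab: "a + b' = a' + b" and ce: "c + e' = c' + e"
    by (simp_all only: K_class_inject)
  have plus: "p + q \<in> diagrams A" if "p \<in> diagrams A" "q \<in> diagrams A" for p q
    using that by (auto simp: diagrams_def)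
  have "r = W1 A ((a' + e') + (b + e)) ((c' + b') + (b + e))"
    unfolding r by (rule W1_cancel[OF met, symmetric]) (intro plus D D')+
  also have "(a' + e') + (b + e) = (a + e) + (b' + e')"
  proof -
    have "(a' + e') + (b + e) = (a' + b) + (e + e')" by (simp add: ac_simps)
    also have "\<dots> = (a + e) + (b' + e')" unfolding ab[symmetric] by (simp add: ac_simps)
    finally show ?thesis .
  qed
  also have "(c' + b') + (b + e) = (c + b) + (b' + e')"
  proof -
    have "(c' + b') + (b + e) = (c' + e) + (b + b')" by (simp add: ac_simps)
    also have "\<dots> = (c + b) + (b' + e')" unfolding ce[symmetric] by (simp add: ac_simps)
    finally show ?thesis .
  qed
  also have "W1 A ((a + e) + (b' + e')) ((c + b) + (b' + e')) = W1 A (a + e) (c + b)"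
    by (rule W1_cancel[OF met]) (intro plus D D')+
  finally show "r = W1 A (a + e) (c + b)" .
qed


subsection \<open>Torus, characters and phases\<close>

text \<open>
  Coordinates of the torus are indexed by the points of \<open>X \ A\<close>. The torus is represented by its
  fundamental domain \<open>[0, 2\<pi>)\<close> in each coordinate, with normalised Lebesgue measure; everything
  integrated below is \<open>2\<pi>\<close>-periodic in each coordinate.
\<close>

definition torus :: "'a set \<Rightarrow> ('a \<Rightarrow> real) measure"
  where "torus A = (\<Pi>\<^sub>M x\<in>- A. uniform_measure lborel {0..<2 * pi})"

definition chi :: "'a set \<Rightarrow> ('a \<Rightarrow> real) \<Rightarrow> ('a \<Rightarrow>\<^sub>0 int) \<Rightarrow> complex"
  where "chi A \<theta> g = cis (\<Sum>x\<in>- A. real_of_int (Poly_Mapping.lookup g x) * \<theta> x)"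

definition phase :: "('a \<Rightarrow> real) \<Rightarrow> 'a option \<Rightarrow> complex"
  where "phase \<theta> u = (case u of None \<Rightarrow> 1 | Some x \<Rightarrow> cis (\<theta> x))"

text \<open>Geodesic distance on the unit circle; \<open>Arg\<close> only serves to choose lifts, see \<open>circle_dist_cis\<close>.\<close>

definition circle_dist :: "complex \<Rightarrow> complex \<Rightarrow> real"
  where "circle_dist z w = (INF k. \<bar>Arg z - Arg w + 2 * pi * real_of_int k\<bar>)"

lemma circle_dist_cis: "circle_dist (cis a) (cis b) = (INF k. \<bar>a - b + 2 * pi * real_of_int k\<bar>)"
proof -
  have "\<exists>m::int. Arg (cis t) = t + 2 * pi * real_of_int m" for t
  proof -
    have "cis (Arg (cis t)) = cis t"
      by (simp add: cis_Arg sgn_div_norm)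
    hence "exp (\<i> * complex_of_real (Arg (cis t))) = exp (\<i> * complex_of_real t)"
      by (simp add: cis_conv_exp)
    then obtain m where "\<i> * complex_of_real (Arg (cis t)) = \<i> * complex_of_real t + complex_of_real (2 * real_of_int m * pi) * \<i>"
      by (auto simp: exp_eq)
    hence "Im (\<i> * complex_of_real (Arg (cis t))) = Im (\<i> * complex_of_real t + complex_of_real (2 * real_of_int m * pi) * \<i>)"
      by (rule arg_cong)
    thus ?thesis by (auto simp: algebra_simps)
  qed
  then obtain m n where m: "Arg (cis a) = a + 2 * pi * real_of_int m"
    and n: "Arg (cis b) = b + 2 * pi * real_of_int n" by blast
  have "range (\<lambda>k::int. \<bar>Arg (cis a) - Arg (cis b) + 2 * pi * real_of_int k\<bar>)
      = range ((\<lambda>k::int. \<bar>a - b + 2 * pi * real_of_int k\<bar>) \<circ> (\<lambda>k. k + (m - n)))"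
    by (intro arg_cong[of _ _ range] ext) (simp add: m n algebra_simps)
  also have "\<dots> = range (\<lambda>k::int. \<bar>a - b + 2 * pi * real_of_int k\<bar>)"
    by (simp only: image_comp[symmetric] surj_plus_right)
  finally show ?thesis by (simp add: circle_dist_def)
qed

definition Lip_chi :: "'a::metric_space set \<Rightarrow> ('a \<Rightarrow> real) \<Rightarrow> ennreal"
  where "Lip_chi A \<theta> = Lip (K_group A) (K_dist A) circle_dist (chi A \<theta>)"


subsection \<open>Graph model\<close>

text \<open>
  A simple undirected graph is a loop-free symmetric digraph whose arcs are pairs of vertices
  (\<^locale>\<open>pair_graph\<close>).
\<close>

definition graph_model :: "'a::metric_space set \<Rightarrow> 'a option pair_pre_digraph \<Rightarrow> bool"
  where "graph_model A G \<longleftrightarrow> pair_graph G \<and> pverts G = quot_pts A \<and>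
    Digraph_Component.connected (with_proj G) \<and>
    (\<forall>u\<in>quot_pts A. \<forall>v\<in>quot_pts A.
      wf_digraph.\<mu> (with_proj G) (\<lambda>(p, q). d1bar A p q) u v = ereal (d1bar A u v))"

definition conductances :: "'v pair_pre_digraph \<Rightarrow> ('v \<Rightarrow> 'v \<Rightarrow> real) \<Rightarrow> bool"
  where "conductances G w \<longleftrightarrow> (\<forall>u\<in>pverts G. \<forall>v\<in>pverts G.
    w u v = w v u \<and> (if (u, v) \<in> parcs G then w u v > 0 else w u v = 0))"

definition dirichlet_energy :: "'a set \<Rightarrow> ('a option \<Rightarrow> 'a option \<Rightarrow> real) \<Rightarrow> ('a \<Rightarrow> real) \<Rightarrow> real"
  where "dirichlet_energy A w \<theta> =
    1 / 2 * (\<Sum>u\<in>quot_pts A. \<Sum>v\<in>quot_pts A. w u v * (cmod (phase \<theta> u - phase \<theta> v))\<^sup>2)"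


subsection \<open>Heat kernel and its reproducing kernel Hilbert space\<close>

definition heat_measure ::
    "'a set \<Rightarrow> ('a option \<Rightarrow> 'a option \<Rightarrow> real) \<Rightarrow> real \<Rightarrow> ('a \<Rightarrow> real) measure"
  where "heat_measure A w t = density (torus A) (\<lambda>\<theta>. ennreal (exp (- t * dirichlet_energy A w \<theta>)))"

definition heat_kernel ::
    "'a set \<Rightarrow> ('a option \<Rightarrow> 'a option \<Rightarrow> real) \<Rightarrow> real \<Rightarrow> ('a \<Rightarrow>\<^sub>0 int) \<Rightarrow> ('a \<Rightarrow>\<^sub>0 int) \<Rightarrow> complex"
  where "heat_kernel A w t \<alpha> \<beta> = (LINT \<theta>|heat_measure A w t. chi A \<theta> (\<alpha> - \<beta>))"

definition ip_norm :: "('f \<Rightarrow> 'f \<Rightarrow> complex) \<Rightarrow> 'f \<Rightarrow> real"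
  where "ip_norm ip f = sqrt (Re (ip f f))"

text \<open>
  \<open>H\<close> with inner product \<open>ip\<close> (linear in the first argument) is the reproducing kernel Hilbert space of
  complex-valued functions on \<open>K\<close> with kernel \<open>k\<close>. A function on \<open>K\<close> is represented by its extension
  by \<open>0\<close> to the whole type.
\<close>

locale rkhs =
  fixes K :: "'k set" and k :: "'k \<Rightarrow> 'k \<Rightarrow> complex"
    and H :: "('k \<Rightarrow> complex) set" and ip :: "('k \<Rightarrow> complex) \<Rightarrow> ('k \<Rightarrow> complex) \<Rightarrow> complex"
  assumes vanish_outside: "f \<in> H \<Longrightarrow> \<alpha> \<notin> K \<Longrightarrow> f \<alpha> = 0"
    and zero_mem: "(\<lambda>_. 0) \<in> H"
    and add_mem: "f \<in> H \<Longrightarrow> g \<in> H \<Longrightarrow> (\<lambda>\<alpha>. f \<alpha> + g \<alpha>) \<in> H"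
    and scale_mem: "f \<in> H \<Longrightarrow> (\<lambda>\<alpha>. c * f \<alpha>) \<in> H"
    and ip_add: "f \<in> H \<Longrightarrow> g \<in> H \<Longrightarrow> h \<in> H \<Longrightarrow> ip (\<lambda>\<alpha>. f \<alpha> + g \<alpha>) h = ip f h + ip g h"
    and ip_scale: "f \<in> H \<Longrightarrow> h \<in> H \<Longrightarrow> ip (\<lambda>\<alpha>. c * f \<alpha>) h = c * ip f h"
    and ip_commute: "f \<in> H \<Longrightarrow> g \<in> H \<Longrightarrow> ip g f = cnj (ip f g)"
    and ip_pos: "f \<in> H \<Longrightarrow> f \<noteq> (\<lambda>_. 0) \<Longrightarrow> Re (ip f f) > 0"
    and complete: "(\<And>n. F n \<in> H) \<Longrightarrow>
      (\<forall>\<epsilon>>0. \<exists>N. \<forall>m\<ge>N. \<forall>n\<ge>N. ip_norm ip (\<lambda>\<alpha>. F m \<alpha> - F n \<alpha>) < \<epsilon>) \<Longrightarrow>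
      \<exists>f\<in>H. (\<lambda>n. ip_norm ip (\<lambda>\<alpha>. F n \<alpha> - f \<alpha>)) \<longlonglongrightarrow> 0"
    and kernel_mem: "\<beta> \<in> K \<Longrightarrow> (\<lambda>\<alpha>. if \<alpha> \<in> K then k \<alpha> \<beta> else 0) \<in> H"
    and reproducing: "f \<in> H \<Longrightarrow> \<beta> \<in> K \<Longrightarrow> f \<beta> = ip f (\<lambda>\<alpha>. if \<alpha> \<in> K then k \<alpha> \<beta> else 0)"

definition heat_Lip_integral ::
    "'a::metric_space set \<Rightarrow> ('a option \<Rightarrow> 'a option \<Rightarrow> real) \<Rightarrow> real \<Rightarrow> ennreal"
  where "heat_Lip_integral A w t =
    (\<integral>\<^sup>+\<theta>. (Lip_chi A \<theta>)\<^sup>2 * ennreal (exp (- t * dirichlet_energy A w \<theta>)) \<partial>torus A)"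

end

theory Submission
  imports Defs
begin

text \<open>
  By the reproducing property and Cauchy-Schwarz, \<open>|f \<alpha> - f \<beta>| \<le> \<parallel>f\<parallel> \<parallel>k\<^sub>\<alpha> - k\<^sub>\<beta>\<parallel>\<close>, and
  \<open>\<parallel>k\<^sub>\<alpha> - k\<^sub>\<beta>\<parallel>\<^sup>2\<close> is the integral of \<open>|\<chi>\<^sub>\<theta> \<alpha> - \<chi>\<^sub>\<theta> \<beta>|\<^sup>2\<close> against the heat measure; as chords are
  shorter than arcs, the integrand is at most \<open>(Lip \<chi>\<^sub>\<theta>)\<^sup>2 \<rho>(\<alpha>, \<beta>)\<^sup>2\<close>. The integral is finite because
  \<open>Lip \<chi>\<^sub>\<theta>\<close> is bounded uniformly in \<open>\<theta>\<close>: arcs have length at most \<open>\<pi>\<close>, while distinct elements of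
  \<open>K(X, A)\<close> are at distance at least the smallest positive value of \<open>d1bar\<close>.
\<close>

subsection \<open>Distances on the circle\<close>

lemma cmod_cis_diff_power2: "(cmod (cis a - cis b))\<^sup>2 = 2 - 2 * cos (a - b)"
  using sin_cos_squared_add[of a] sin_cos_squared_add[of b]
  unfolding cmod_power2 by (simp add: cos_diff power2_eq_square algebra_simps)

text \<open>The chord has length 2 |sin ((a - b) / 2)|, and |sin x| \<le> |x|.\<close>

lemma cmod_cis_diff_le: "cmod (cis a - cis b) \<le> \<bar>a - b\<bar>"
proof -
  have "cos (a - b) = 1 - 2 * (sin ((a - b) / 2))\<^sup>2"
    using cos_double_sin[of "(a - b) / 2"] by (simp del: right_diff_distrib_numeral)
  hence "(cmod (cis a - cis b))\<^sup>2 = 4 * (sin ((a - b) / 2))\<^sup>2"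
    by (simp add: cmod_cis_diff_power2)
  also have "\<dots> \<le> 4 * ((a - b) / 2)\<^sup>2"
    using abs_sin_x_le_abs_x[of "(a - b) / 2"] unfolding abs_le_square_iff by (rule mult_left_mono) simp
  also have "\<dots> = \<bar>a - b\<bar>\<^sup>2"
    by (simp add: power_divide)
  finally show ?thesis
    by (rule power2_le_imp_le) simp
qed

text \<open>Shifting \<open>a\<close> by a multiple of 2 pi leaves the chord unchanged, so the chord
  lies below every competitor in the infimum of \<open>circle_dist_cis\<close>.\<close>

lemma cmod_diff_le_circle_dist: "cmod (cis a - cis b) \<le> circle_dist (cis a) (cis b)"
  unfolding circle_dist_cis
proof (rule cINF_greatest)
  fix k :: int
  have "cis (a + 2 * pi * k) = cis a"
    by (simp add: cis_mult[symmetric])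
  thus "cmod (cis a - cis b) \<le> \<bar>a - b + 2 * pi * real_of_int k\<bar>"
    using cmod_cis_diff_le[of "a + 2 * pi * k" b] by (simp add: algebra_simps)
qed simp

lemma circle_dist_le_pi: "circle_dist (cis a) (cis b) \<le> pi"
proof -
  \<comment> \<open>Rounding selects the lift of \<open>a\<close> nearest to \<open>b\<close>, which
    is at most half a turn away.\<close>
  define k where "k = - round ((a - b) / (2 * pi))"
  have bdd: "bdd_below (range (\<lambda>k::int. \<bar>a - b + 2 * pi * real_of_int k\<bar>))"
    by (rule bdd_belowI[of _ 0]) auto
  have "\<bar>(a - b) / (2 * pi) + real_of_int k\<bar> \<le> 1 / 2"
    using of_int_round_abs_le[of "(a - b) / (2 * pi)"] by (simp add: k_def abs_minus_commute)
  moreover have "\<bar>a - b + 2 * pi * real_of_int k\<bar> = 2 * pi * \<bar>(a - b) / (2 * pi) + real_of_int k\<bar>"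
    by (simp add: abs_mult[of "2 * pi", simplified, symmetric] distrib_left)
  ultimately have "\<bar>a - b + 2 * pi * real_of_int k\<bar> \<le> 2 * pi * (1 / 2)"
    by (simp only:) (intro mult_left_mono; simp)
  thus ?thesis
    unfolding circle_dist_cis using cINF_lower2[OF bdd UNIV_I, of k pi] by simp
qed


subsection \<open>\<open>K(X, A)\<close> is uniformly discrete\<close>

lemma d1bar_separated:
  assumes "Metric_space (quot_pts A) (d1bar A)" "finite (- A)"
  obtains \<delta> where "\<delta> > 0" "\<And>u v. u \<in> quot_pts A \<Longrightarrow> v \<in> quot_pts A \<Longrightarrow> u \<noteq> v \<Longrightarrow> \<delta> \<le> d1bar A u v"
proof -
  interpret Metric_space "quot_pts A" "d1bar A" by fact
  \<comment> \<open>The element 1 makes the set nonempty, so \<open>Min\<close> is meaningful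
    without exhibiting two distinct points.\<close>
  let ?S = "insert 1 ((\<lambda>(u, v). d1bar A u v) ` {(u, v) \<in> quot_pts A \<times> quot_pts A. u \<noteq> v})"
  have "finite (quot_pts A \<times> quot_pts A)"
    using assms(2) by (simp add: quot_pts_def)
  hence fin: "finite ?S"
    by (auto intro!: finite_imageI intro: finite_subset[rotated])
  have "Min ?S > 0"
    using fin by (subst Min_gr_iff) (auto simp: mdist_pos_eq)
  moreover have "Min ?S \<le> d1bar A u v" if "u \<in> quot_pts A" "v \<in> quot_pts A" "u \<noteq> v" for u v
    using fin that by (intro Min_le) auto
  ultimately show thesis by (rule that)
qed

text \<open>A matching made only of pairs (u, u) has equal marginals, so a matching of distinct
  diagrams contains a pair with u \<noteq> v. That pair costs at least \<delta>, and the other costs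
  are nonnegative.\<close>

lemma W1_ge:
  assumes met: "Metric_space (quot_pts A) (d1bar A)"
    and \<delta>: "\<And>u v. u \<in> quot_pts A \<Longrightarrow> v \<in> quot_pts A \<Longrightarrow> u \<noteq> v \<Longrightarrow> \<delta> \<le> d1bar A u v"
    and "\<alpha> \<in> diagrams A" "\<beta> \<in> diagrams A" "\<alpha> \<noteq> \<beta>"
  shows "\<delta> \<le> W1 A \<alpha> \<beta>"
  unfolding W1_def
proof (rule cINF_greatest)
  interpret Metric_space "quot_pts A" "d1bar A" by fact
  show "matchings A \<alpha> \<beta> \<noteq> {}"
    using assms by (intro matchings_nonempty)
  fix M assume M: "M \<in> matchings A \<alpha> \<beta>"
  have "\<exists>(u, v)\<in>#M. u \<noteq> v"
  proof (rule ccontr)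
    assume "\<not> ?thesis"
    hence "image_mset (\<lambda>(u, v). pt u) M = image_mset (\<lambda>(u, v). pt v) M"
      by (intro image_mset_cong) auto
    hence "(\<Sum>(u, v)\<in>#M. pt u) = (\<Sum>(u, v)\<in>#M. pt v)"
      by (rule arg_cong)
    moreover have "(\<Sum>(u, v)\<in>#M. pt u) = \<alpha>" "(\<Sum>(u, v)\<in>#M. pt v) = \<beta>"
      using M by (simp_all add: matchings_def)
    ultimately show False
      using \<open>\<alpha> \<noteq> \<beta>\<close> by metis
  qed
  then obtain u v L where L: "M = add_mset (u, v) L" "u \<noteq> v"
    by (auto dest: multi_member_split)
  have "0 \<le> (\<Sum>(u, v)\<in>#L. d1bar A u v)"
    by (induction L) auto
  moreover have "\<delta> \<le> d1bar A u v"
    using M L by (intro \<delta>) (auto simp: matchings_def)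
  ultimately show "\<delta> \<le> (\<Sum>(u, v)\<in>#M. d1bar A u v)"
    by (simp add: L)
qed

text \<open>Brings group elements into the form on which \<open>K_dist_eq\<close> evaluates the
  metric. The induction runs over generators and differences, using (a - b) - (c - e) = (a + e) - (b
  + c).\<close>

lemma K_group_eq_diff:
  assumes "g \<in> K_group A"
  obtains a b where "a \<in> diagrams A" "b \<in> diagrams A" "g = K_class a - K_class b"
proof -
  have "Poly_Mapping.keys g \<subseteq> - A"
    using assms by (simp add: K_group_def)
  hence "\<exists>a\<in>diagrams A. \<exists>b\<in>diagrams A. g = K_class a - K_class b"
  proof (induction rule: frag_induction)
    case zero
    show ?case
      by (rule bexI[of _ "{#}"], rule bexI[of _ "{#}"]) (auto simp: diagrams_def)
  next
    case (one x)
    thus ?case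
      by (intro bexI[of _ "{#x#}"] bexI[of _ "{#}"]) (auto simp: diagrams_def K_class_def)
  next
    case (diff g h)
    then obtain a b c e where
      "a \<in> diagrams A" "b \<in> diagrams A" "g = K_class a - K_class b"
      "c \<in> diagrams A" "e \<in> diagrams A" "h = K_class c - K_class e"
      by blast
    thus ?case
      by (intro bexI[of _ "a + e"] bexI[of _ "b + c"]) (auto simp: diagrams_def K_class_add)
  qed
  thus thesis using that by blast
qed

lemma K_dist_separated:
  assumes met: "Metric_space (quot_pts A) (d1bar A)" and fin: "finite (- A)"
  obtains \<delta> where "\<delta> > 0" "\<And>g h. g \<in> K_group A \<Longrightarrow> h \<in> K_group A \<Longrightarrow> g \<noteq> h \<Longrightarrow> \<delta> \<le> K_dist A g h"
proof -
  obtain \<delta> where \<delta>: "\<delta> > 0"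
    "\<And>u v. u \<in> quot_pts A \<Longrightarrow> v \<in> quot_pts A \<Longrightarrow> u \<noteq> v \<Longrightarrow> \<delta> \<le> d1bar A u v"
    using d1bar_separated[OF assms] by blast
  have "\<delta> \<le> K_dist A g h" if gh: "g \<in> K_group A" "h \<in> K_group A" "g \<noteq> h" for g h
  proof -
    obtain a b where ab: "a \<in> diagrams A" "b \<in> diagrams A" "g = K_class a - K_class b"
      using K_group_eq_diff[OF gh(1)] .
    obtain c e where ce: "c \<in> diagrams A" "e \<in> diagrams A" "h = K_class c - K_class e"
      using K_group_eq_diff[OF gh(2)] .
    \<comment> \<open>Equality here would rearrange to g = h. The two diagrams are exactly the
      arguments of \<open>W1\<close> in \<open>K_dist_eq\<close>.\<close>
    have "K_class (a + e) \<noteq> K_class (c + b)"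
      using gh(3) ab(3) ce(3) by (auto simp: K_class_add algebra_simps)
    hence "a + e \<noteq> c + b" by auto
    moreover have "a + e \<in> diagrams A" "c + b \<in> diagrams A"
      using ab ce by (auto simp: diagrams_def)
    ultimately show ?thesis
      using ab ce W1_ge[OF met \<delta>(2)] by (simp add: K_dist_eq[OF met])
  qed
  with \<delta>(1) show thesis by (rule that)
qed


subsection \<open>Characters\<close>

lemma Lip_upper:
  assumes "\<alpha> \<in> M" "\<beta> \<in> M" "\<alpha> \<noteq> \<beta>"
  shows "ennreal (\<rho>2 (f \<alpha>) (f \<beta>)) / ennreal (\<rho>1 \<alpha> \<beta>) \<le> Lip M \<rho>1 \<rho>2 f"
  unfolding Lip_def using assms by (intro SUP_upper2[of "(\<alpha>, \<beta>)"]) auto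

lemma Lip_least:
  assumes "\<And>\<alpha> \<beta>. \<alpha> \<in> M \<Longrightarrow> \<beta> \<in> M \<Longrightarrow> \<alpha> \<noteq> \<beta> \<Longrightarrow> ennreal (\<rho>2 (f \<alpha>) (f \<beta>)) / ennreal (\<rho>1 \<alpha> \<beta>) \<le> c"
  shows "Lip M \<rho>1 \<rho>2 f \<le> c"
  unfolding Lip_def using assms by (intro SUP_least) auto

lemma chi_0 [simp]: "chi A \<theta> 0 = 1"
  by (simp add: chi_def)

text \<open>The two real parts coincide; they are kept apart so that, after integration, they match
  the mixed kernel values at (\<alpha>, \<beta>) and (\<beta>, \<alpha>).\<close>

lemma cmod_chi_diff_power2:
  "(cmod (chi A \<theta> \<alpha> - chi A \<theta> \<beta>))\<^sup>2 = 2 - Re (chi A \<theta> (\<alpha> - \<beta>)) - Re (chi A \<theta> (\<beta> - \<alpha>))"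
proof -
  have "Re (chi A \<theta> (g - h)) = cos ((\<Sum>x\<in>- A. real_of_int (Poly_Mapping.lookup g x) * \<theta> x)
      - (\<Sum>x\<in>- A. real_of_int (Poly_Mapping.lookup h x) * \<theta> x))" for g h
    by (simp add: chi_def lookup_minus sum_subtractf left_diff_distrib)
  thus ?thesis
    unfolding chi_def[of A \<theta> \<alpha>] chi_def[of A \<theta> \<beta>] cmod_cis_diff_power2
    by (simp add: cos_diff algebra_simps)
qed

lemma Lip_chi_bounded:
  assumes "Metric_space (quot_pts A) (d1bar A)" "finite (- A)"
  obtains C where "C \<ge> 0" "\<And>\<theta>. Lip_chi A \<theta> \<le> ennreal C"
proof -
  obtain \<delta> where \<delta>: "\<delta> > 0" "\<And>g h. g \<in> K_group A \<Longrightarrow> h \<in> K_group A \<Longrightarrow> g \<noteq> h \<Longrightarrow> \<delta> \<le> K_dist A g h"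
    using K_dist_separated[OF assms] by blast
  have "Lip_chi A \<theta> \<le> ennreal (pi / \<delta>)" for \<theta>
    unfolding Lip_chi_def
  proof (rule Lip_least)
    fix \<alpha> \<beta> assume "\<alpha> \<in> K_group A" "\<beta> \<in> K_group A" "\<alpha> \<noteq> \<beta>"
    hence K: "\<delta> \<le> K_dist A \<alpha> \<beta>" by (rule \<delta>(2))
    \<comment> \<open>Nonnegativity of the arc, required by \<open>divide_ennreal\<close>, comes
      from the chord below it.\<close>
    have "circle_dist (chi A \<theta> \<alpha>) (chi A \<theta> \<beta>) \<le> pi" "0 \<le> circle_dist (chi A \<theta> \<alpha>) (chi A \<theta> \<beta>)"
      unfolding chi_def using circle_dist_le_pi order.trans[OF norm_ge_zero cmod_diff_le_circle_dist]
      by blast+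
    thus "ennreal (circle_dist (chi A \<theta> \<alpha>) (chi A \<theta> \<beta>)) / ennreal (K_dist A \<alpha> \<beta>) \<le> ennreal (pi / \<delta>)"
      using K \<delta>(1) by (subst divide_ennreal) (auto intro!: ennreal_leI frac_le)
  qed
  moreover have "pi / \<delta> \<ge> 0"
    using \<delta>(1) by simp
  ultimately show thesis using that by blast
qed


subsection \<open>The heat measure\<close>

lemma prob_space_torus: "prob_space (torus A)"
proof -
  have "emeasure lborel {0..<2 * pi} = ennreal (2 * pi)"
    by simp
  hence "prob_space (uniform_measure lborel {0..<2 * pi})"
    by (intro prob_space_uniform_measure) (auto simp: ennreal_eq_0_iff not_le)
  thus ?thesis
    unfolding torus_def by (intro prob_space_PiM)
qed

lemma measurable_torus_component [measurable]:
  assumes "x \<notin> A"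
  shows "(\<lambda>\<theta>. \<theta> x) \<in> borel_measurable (torus A)"
proof -
  have "(\<lambda>\<theta>. \<theta> x) \<in> measurable (torus A) (uniform_measure lborel {0..<2 * pi})"
    unfolding torus_def using assms by (intro measurable_component_singleton) simp
  thus ?thesis
    by (simp add: measurable_def)
qed

lemma measurable_cis [measurable]: "cis \<in> borel_measurable borel"
  by (intro borel_measurable_continuous_onI continuous_intros)

lemma measurable_chi [measurable]: "(\<lambda>\<theta>. chi A \<theta> g) \<in> borel_measurable (torus A)"
  unfolding chi_def by measurable

lemma measurable_dirichlet_energy [measurable]:
  "dirichlet_energy A w \<in> borel_measurable (torus A)"
proof -
  have [measurable]: "(\<lambda>\<theta>. phase \<theta> u) \<in> borel_measurable (torus A)" if "u \<in> quot_pts A" for u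
  proof (cases u)
    case (Some x)
    with that have [measurable]: "(\<lambda>\<theta>. \<theta> x) \<in> borel_measurable (torus A)"
      by (auto simp: quot_pts_def intro: measurable_torus_component)
    show ?thesis
      unfolding phase_def Some option.case by measurable
  qed (simp add: phase_def)
  show ?thesis
    unfolding dirichlet_energy_def by measurable
qed

lemma dirichlet_energy_nonneg:
  assumes "\<And>u v. u \<in> quot_pts A \<Longrightarrow> v \<in> quot_pts A \<Longrightarrow> 0 \<le> w u v"
  shows "0 \<le> dirichlet_energy A w \<theta>"
  unfolding dirichlet_energy_def using assms by (intro mult_nonneg_nonneg sum_nonneg) auto

lemma finite_measure_heat:
  assumes "\<And>\<theta>. 0 \<le> dirichlet_energy A w \<theta>" "t > 0"
  shows "finite_measure (heat_measure A w t)"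
proof
  interpret prob_space "torus A" by (rule prob_space_torus)
  have "emeasure (heat_measure A w t) (space (heat_measure A w t))
      = (\<integral>\<^sup>+\<theta>. ennreal (exp (- t * dirichlet_energy A w \<theta>)) \<partial>torus A)"
    unfolding heat_measure_def by (simp add: emeasure_density cong: nn_integral_cong)
  \<comment> \<open>The energy is nonnegative, so the density is at most 1 and the torus has mass
    1.\<close>
  also have "\<dots> \<le> (\<integral>\<^sup>+\<theta>. 1 \<partial>torus A)"
    using assms by (intro nn_integral_mono) (simp add: ennreal_le_1)
  also have "\<dots> = 1"
    by (simp add: emeasure_space_1)
  finally show "emeasure (heat_measure A w t) (space (heat_measure A w t)) \<noteq> \<infinity>"
    by (auto simp: top_unique)
qed

lemma heat_Lip_integral_finite:
  assumes "Metric_space (quot_pts A) (d1bar A)" "finite (- A)"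
    and "\<And>\<theta>. 0 \<le> dirichlet_energy A w \<theta>" "t > 0"
  shows "heat_Lip_integral A w t < \<infinity>"
proof -
  interpret prob_space "torus A" by (rule prob_space_torus)
  obtain C where C: "C \<ge> 0" "\<And>\<theta>. Lip_chi A \<theta> \<le> ennreal C"
    using Lip_chi_bounded[OF assms(1,2)] by blast
  have "heat_Lip_integral A w t \<le> (\<integral>\<^sup>+\<theta>. (ennreal C)\<^sup>2 * 1 \<partial>torus A)"
    unfolding heat_Lip_integral_def using assms(3,4) C(2)
    by (intro nn_integral_mono mult_mono power_mono) (simp_all add: ennreal_le_1)
  also have "\<dots> = ennreal (C\<^sup>2)"
    using C(1) by (simp add: emeasure_space_1 ennreal_power)
  finally show ?thesis
    by (simp add: le_less_trans)
qed

text \<open>Nonnegative energy makes the integrand nonincreasing in \<open>t\<close> at each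
  \<theta>.\<close>

lemma heat_Lip_integral_antimono:
  assumes "\<And>\<theta>. 0 \<le> dirichlet_energy A w \<theta>"
  shows "antimono (heat_Lip_integral A w)"
proof (rule antimonoI)
  fix s t :: real assume "s \<le> t"
  thus "heat_Lip_integral A w t \<le> heat_Lip_integral A w s"
    unfolding heat_Lip_integral_def using assms
    by (intro nn_integral_mono mult_left_mono ennreal_leI) (auto intro: mult_right_mono)
qed

text \<open>The right-hand side is the squared RKHS norm of the difference of the kernel sections at
  \<alpha> and \<beta>. Characters have modulus 1, hence are integrable against the finite heat
  measure, and the squared chord expands into four of them.\<close>

lemma heat_kernel_dist:
  assumes "\<And>\<theta>. 0 \<le> dirichlet_energy A w \<theta>" "t > 0"
  shows "(\<integral>\<^sup>+\<theta>. ennreal ((cmod (chi A \<theta> \<alpha> - chi A \<theta> \<beta>))\<^sup>2) \<partial>heat_measure A w t)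
    = ennreal (Re (heat_kernel A w t \<alpha> \<alpha> - heat_kernel A w t \<alpha> \<beta>
        - heat_kernel A w t \<beta> \<alpha> + heat_kernel A w t \<beta> \<beta>))"
proof -
  interpret finite_measure "heat_measure A w t"
    by (rule finite_measure_heat[OF assms])
  have chi_meas [measurable]: "(\<lambda>\<theta>. chi A \<theta> g) \<in> borel_measurable (heat_measure A w t)" for g
    by (simp add: heat_measure_def)
  have int [simp]: "integrable (heat_measure A w t) (\<lambda>\<theta>. chi A \<theta> g)" for g
    by (rule integrable_const_bound[of _ 1]) (simp_all add: chi_def chi_meas[unfolded chi_def])
  have "(\<integral>\<^sup>+\<theta>. ennreal ((cmod (chi A \<theta> \<alpha> - chi A \<theta> \<beta>))\<^sup>2) \<partial>heat_measure A w t)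
      = ennreal (LINT \<theta>|heat_measure A w t. (cmod (chi A \<theta> \<alpha> - chi A \<theta> \<beta>))\<^sup>2)"
  proof (rule nn_integral_eq_integral)
    show "integrable (heat_measure A w t) (\<lambda>\<theta>. (cmod (chi A \<theta> \<alpha> - chi A \<theta> \<beta>))\<^sup>2)"
      by (simp add: cmod_chi_diff_power2)
  qed simp
  \<comment> \<open>The constant 2 is written as the characters at \<alpha> - \<alpha> and \<beta> -
    \<beta>, so that each of the four terms integrates to a kernel value.\<close>
  also have "(LINT \<theta>|heat_measure A w t. (cmod (chi A \<theta> \<alpha> - chi A \<theta> \<beta>))\<^sup>2)
      = (LINT \<theta>|heat_measure A w t.
          Re (chi A \<theta> (\<alpha> - \<alpha>) - chi A \<theta> (\<alpha> - \<beta>) - chi A \<theta> (\<beta> - \<alpha>) + chi A \<theta> (\<beta> - \<beta>)))"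
    by (simp add: cmod_chi_diff_power2 algebra_simps)
  also have "\<dots> = Re (LINT \<theta>|heat_measure A w t.
          chi A \<theta> (\<alpha> - \<alpha>) - chi A \<theta> (\<alpha> - \<beta>) - chi A \<theta> (\<beta> - \<alpha>) + chi A \<theta> (\<beta> - \<beta>))"
    by (intro integral_Re Bochner_Integration.integrable_add Bochner_Integration.integrable_diff int)
  also have "(LINT \<theta>|heat_measure A w t.
          chi A \<theta> (\<alpha> - \<alpha>) - chi A \<theta> (\<alpha> - \<beta>) - chi A \<theta> (\<beta> - \<alpha>) + chi A \<theta> (\<beta> - \<beta>))
      = heat_kernel A w t \<alpha> \<alpha> - heat_kernel A w t \<alpha> \<beta> - heat_kernel A w t \<beta> \<alpha> + heat_kernel A w t \<beta> \<beta>"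
    unfolding heat_kernel_def
    by (simp only: Bochner_Integration.integral_add Bochner_Integration.integral_diff int
        Bochner_Integration.integrable_add Bochner_Integration.integrable_diff)
  finally show ?thesis .
qed

text \<open>
  \<open>Lip_chi\<close> enters only as a pointwise upper bound, so its measurability in \<open>\<theta>\<close> plays no role.
\<close>

lemma heat_kernel_dist_le:
  assumes "\<And>\<theta>. 0 \<le> dirichlet_energy A w \<theta>" "t > 0"
    and \<alpha>\<beta>: "\<alpha> \<in> K_group A" "\<beta> \<in> K_group A" "\<alpha> \<noteq> \<beta>" and pos: "K_dist A \<alpha> \<beta> > 0"
  shows "ennreal (Re (heat_kernel A w t \<alpha> \<alpha> - heat_kernel A w t \<alpha> \<beta>
        - heat_kernel A w t \<beta> \<alpha> + heat_kernel A w t \<beta> \<beta>) / (K_dist A \<alpha> \<beta>)\<^sup>2) \<le> heat_Lip_integral A w t"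
    (is "ennreal (?D / ?r\<^sup>2) \<le> _")
proof -
  let ?c = "\<lambda>\<theta>. (cmod (chi A \<theta> \<alpha> - chi A \<theta> \<beta>))\<^sup>2"
  have "ennreal (?D / ?r\<^sup>2) = ennreal (1 / ?r\<^sup>2) * (\<integral>\<^sup>+\<theta>. ennreal (?c \<theta>) \<partial>heat_measure A w t)"
    using pos by (simp add: heat_kernel_dist[OF assms(1,2)] flip: ennreal_mult')
  also have "\<dots> = ennreal (1 / ?r\<^sup>2) *
      (\<integral>\<^sup>+\<theta>. ennreal (exp (- t * dirichlet_energy A w \<theta>)) * ennreal (?c \<theta>) \<partial>torus A)"
    unfolding heat_measure_def by (subst nn_integral_density) simp_all
  \<comment> \<open>\<open>nn_integral_cmult\<close> asks for a measurable integrand, so the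
    constant moves inside before \<open>Lip_chi\<close> enters.\<close>
  also have "\<dots> = (\<integral>\<^sup>+\<theta>. ennreal (1 / ?r\<^sup>2) *
      (ennreal (exp (- t * dirichlet_energy A w \<theta>)) * ennreal (?c \<theta>)) \<partial>torus A)"
    by (subst nn_integral_cmult) simp_all
  also have "\<dots> \<le> heat_Lip_integral A w t"
    unfolding heat_Lip_integral_def
  proof (rule nn_integral_mono)
    fix \<theta>
    let ?e = "ennreal (exp (- t * dirichlet_energy A w \<theta>))"
    \<comment> \<open>Chord below arc; the arc quotient is then a single term of the supremum
      \<open>Lip_chi\<close>.\<close>
    have "ennreal (cmod (chi A \<theta> \<alpha> - chi A \<theta> \<beta>) / ?r)
        \<le> ennreal (circle_dist (chi A \<theta> \<alpha>) (chi A \<theta> \<beta>)) / ennreal ?r"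
      using pos unfolding chi_def
      by (simp add: cmod_diff_le_circle_dist divide_right_mono divide_right_mono_ennreal ennreal_leI
          flip: divide_ennreal)
    also have "\<dots> \<le> Lip_chi A \<theta>"
      unfolding Lip_chi_def using \<alpha>\<beta> by (rule Lip_upper)
    finally have "(ennreal (cmod (chi A \<theta> \<alpha> - chi A \<theta> \<beta>) / ?r))\<^sup>2 \<le> (Lip_chi A \<theta>)\<^sup>2"
      by (intro power_mono) simp_all
    hence "ennreal (1 / ?r\<^sup>2) * ennreal (?c \<theta>) \<le> (Lip_chi A \<theta>)\<^sup>2"
      using pos by (simp add: ennreal_power power_divide flip: ennreal_mult)
    thus "ennreal (1 / ?r\<^sup>2) * (?e * ennreal (?c \<theta>)) \<le> (Lip_chi A \<theta>)\<^sup>2 * ?e"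
      using mult_right_mono[OF _ zero_le, of "ennreal (1 / ?r\<^sup>2) * ennreal (?c \<theta>)" _ ?e]
      by (simp only: ac_simps)
  qed
  finally show ?thesis .
qed


subsection \<open>Reproducing kernel Hilbert spaces\<close>

context rkhs
begin

lemma diff_mem: "f \<in> H \<Longrightarrow> g \<in> H \<Longrightarrow> (\<lambda>\<alpha>. f \<alpha> - g \<alpha>) \<in> H"
  using add_mem[of f "\<lambda>\<alpha>. - 1 * g \<alpha>"] scale_mem[of g "- 1"] by simp

lemma ip_diff:
  assumes "f \<in> H" "g \<in> H" "h \<in> H"
  shows "ip (\<lambda>\<alpha>. f \<alpha> - g \<alpha>) h = ip f h - ip g h"
  using ip_add[of f "\<lambda>\<alpha>. - 1 * g \<alpha>" h] ip_scale[of g h "- 1"] scale_mem[of g "- 1"] assms by simp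

lemma ip_diff_right:
  assumes "f \<in> H" "g \<in> H" "h \<in> H"
  shows "ip h (\<lambda>\<alpha>. f \<alpha> - g \<alpha>) = ip h f - ip h g"
  using assms ip_commute[of "\<lambda>\<alpha>. f \<alpha> - g \<alpha>" h] ip_commute[of f h] ip_commute[of g h]
  by (simp add: diff_mem ip_diff)

lemma ip_scale_right:
  assumes "f \<in> H" "h \<in> H"
  shows "ip h (\<lambda>\<alpha>. c * f \<alpha>) = cnj c * ip h f"
  using assms ip_commute[of "\<lambda>\<alpha>. c * f \<alpha>" h] ip_commute[of f h]
  by (simp add: scale_mem ip_scale)

lemma ip_zero_left: "h \<in> H \<Longrightarrow> ip (\<lambda>_. 0) h = 0"
  using ip_scale[of h h 0] by simp

lemma ip_self_nonneg: "f \<in> H \<Longrightarrow> 0 \<le> Re (ip f f)"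
  using ip_pos[of f] ip_zero_left[OF zero_mem] by (cases "f = (\<lambda>_. 0)") auto

lemma ip_self_eq: "f \<in> H \<Longrightarrow> ip f f = complex_of_real (Re (ip f f))"
  using ip_commute[of f f] by (simp add: complex_eq_iff)

text \<open>Subtracting from \<open>f\<close> its orthogonal projection onto \<open>g\<close> leaves
  a vector whose squared norm is nonnegative. The case g = 0 is separate because the projection
  divides by the squared norm of \<open>g\<close>.\<close>

lemma Cauchy_Schwarz:
  assumes "f \<in> H" "g \<in> H"
  shows "cmod (ip f g) \<le> ip_norm ip f * ip_norm ip g"
proof (cases "g = (\<lambda>_. 0)")
  case True
  thus ?thesis
    using assms ip_commute[of g f] ip_zero_left ip_self_nonneg
    by (simp add: ip_norm_def)
next
  case False
  define r where "r = Re (ip g g)"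
  define c where "c = ip f g / complex_of_real r"
  have r: "r > 0" "ip g g = complex_of_real r"
    using ip_pos[OF assms(2) False] ip_self_eq[OF assms(2)] by (simp_all add: r_def)
  let ?h = "\<lambda>\<alpha>. f \<alpha> - c * g \<alpha>"
  have "ip ?h ?h = ip f f - cnj c * ip f g - c * (cnj (ip f g) - cnj c * complex_of_real r)"
    using assms r ip_commute[of f g]
    by (simp add: scale_mem diff_mem ip_diff ip_diff_right ip_scale ip_scale_right algebra_simps)
  \<comment> \<open>By the choice of \<open>c\<close> the last bracket vanishes, since the residual
    is orthogonal to \<open>g\<close>.\<close>
  also have "\<dots> = ip f f - complex_of_real ((cmod (ip f g))\<^sup>2 / r)"
    using r by (simp add: c_def complex_norm_square[symmetric] mult.commute)
  finally have "Re (ip ?h ?h) = Re (ip f f) - (cmod (ip f g))\<^sup>2 / r"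
    by simp
  moreover have "0 \<le> Re (ip ?h ?h)"
    using assms by (intro ip_self_nonneg diff_mem scale_mem)
  ultimately have "(cmod (ip f g))\<^sup>2 / r \<le> Re (ip f f)"
    by linarith
  hence "(cmod (ip f g))\<^sup>2 \<le> Re (ip f f) * Re (ip g g)"
    using r by (simp add: pos_divide_le_eq flip: r_def)
  thus ?thesis
    unfolding ip_norm_def by (simp add: real_le_rsqrt flip: real_sqrt_mult)
qed

text \<open>The difference of values is the inner product of \<open>f\<close> with the difference of
  two kernel sections; applying the reproducing property to the sections themselves evaluates the
  norm of that difference.\<close>

lemma cmod_diff_le:
  assumes "f \<in> H" "\<alpha> \<in> K" "\<beta> \<in> K"
  shows "cmod (f \<alpha> - f \<beta>) \<le> ip_norm ip f * sqrt (Re (k \<alpha> \<alpha> - k \<alpha> \<beta> - k \<beta> \<alpha> + k \<beta> \<beta>))"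
proof -
  define k\<alpha> k\<beta> where "k\<alpha> = (\<lambda>\<gamma>. if \<gamma> \<in> K then k \<gamma> \<alpha> else 0)" and "k\<beta> = (\<lambda>\<gamma>. if \<gamma> \<in> K then k \<gamma> \<beta> else 0)"
  have mem: "k\<alpha> \<in> H" "k\<beta> \<in> H"
    unfolding k\<alpha>_def k\<beta>_def using assms kernel_mem by blast+
  have rep: "ip g k\<alpha> = g \<alpha>" "ip g k\<beta> = g \<beta>" if "g \<in> H" for g
    unfolding k\<alpha>_def k\<beta>_def using that assms reproducing by metis+
  let ?D = "\<lambda>\<gamma>. k\<alpha> \<gamma> - k\<beta> \<gamma>"
  have "ip ?D ?D = k \<alpha> \<alpha> - k \<alpha> \<beta> - k \<beta> \<alpha> + k \<beta> \<beta>"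
    \<comment> \<open>The sections stay folded until \<open>rep\<close> has turned the four inner
      products into point values.\<close>
    using mem assms by (simp add: ip_diff ip_diff_right diff_mem rep) (simp add: k\<alpha>_def k\<beta>_def)
  hence "ip_norm ip ?D = sqrt (Re (k \<alpha> \<alpha> - k \<alpha> \<beta> - k \<beta> \<alpha> + k \<beta> \<beta>))"
    by (simp add: ip_norm_def)
  moreover have "f \<alpha> - f \<beta> = ip f ?D"
    using assms mem by (simp add: ip_diff_right rep)
  ultimately show ?thesis
    using Cauchy_Schwarz[OF assms(1) diff_mem[OF mem]] by simp
qed

end

text \<open>The RKHS enters as an arbitrary pair \<open>H\<close>, \<open>ip\<close> satisfying
  \<open>rkhs\<close>. Passing through \<open>enn2real\<close> loses nothing, as the integral is
  finite for t > 0.\<close>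

theorem theorem5p2:
  fixes A :: "'a::metric_space set"
    and G :: "'a option pair_pre_digraph"
    and w :: "'a option \<Rightarrow> 'a option \<Rightarrow> real"
  assumes "A \<noteq> {}"
    and "finite (- A)" and "card (- A) \<ge> 1"
    and "Metric_space (quot_pts A) (d1bar A)"
    and "graph_model A G"
    and "conductances G w"
  shows "(\<forall>t>0. \<forall>H ip. rkhs (K_group A) (heat_kernel A w t) H ip \<longrightarrow>
            (\<forall>f\<in>H. Lip (K_group A) (K_dist A) dist f
                    \<le> ennreal (ip_norm ip f * sqrt (enn2real (heat_Lip_integral A w t)))))
       \<and> (\<forall>t>0. heat_Lip_integral A w t < \<infinity>)
       \<and> antimono_on {0<..} (heat_Lip_integral A w)"
proof -
  \<comment> \<open>Conductances are positive on arcs and zero elsewhere, and the vertex set is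
    \<open>quot_pts A\<close>.\<close>
  have "0 \<le> w u v" if "u \<in> quot_pts A" "v \<in> quot_pts A" for u v
    using assms(5,6) that unfolding graph_model_def conductances_def
    by (metis less_eq_real_def order_refl)
  hence energy: "0 \<le> dirichlet_energy A w \<theta>" for \<theta>
    by (rule dirichlet_energy_nonneg)
  have fin: "heat_Lip_integral A w t < \<infinity>" if "t > 0" for t
    using assms(4,2) energy that by (rule heat_Lip_integral_finite)
  have "Lip (K_group A) (K_dist A) dist f
      \<le> ennreal (ip_norm ip f * sqrt (enn2real (heat_Lip_integral A w t)))"
    if t: "t > 0" and H: "rkhs (K_group A) (heat_kernel A w t) H ip" and f: "f \<in> H" for t H ip f
  proof (rule Lip_least)
    interpret rkhs "K_group A" "heat_kernel A w t" H ip by fact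
    fix \<alpha> \<beta> assume \<alpha>\<beta>: "\<alpha> \<in> K_group A" "\<beta> \<in> K_group A" "\<alpha> \<noteq> \<beta>"
    let ?r = "K_dist A \<alpha> \<beta>" and ?I = "enn2real (heat_Lip_integral A w t)"
    let ?D = "Re (heat_kernel A w t \<alpha> \<alpha> - heat_kernel A w t \<alpha> \<beta>
        - heat_kernel A w t \<beta> \<alpha> + heat_kernel A w t \<beta> \<beta>)"
    obtain \<delta> where "\<delta> > 0" "\<delta> \<le> ?r"
      using K_dist_separated[OF assms(4,2)] \<alpha>\<beta> by metis
    hence r: "?r > 0" by simp
    \<comment> \<open>Finiteness of the integral identifies it with \<open>ennreal ?I\<close>, so
      the estimate descends to the reals.\<close>
    have "ennreal (?D / ?r\<^sup>2) \<le> ennreal ?I"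
      using heat_kernel_dist_le[OF energy t \<alpha>\<beta> r] fin[OF t] by simp
    hence "?D / ?r\<^sup>2 \<le> ?I"
      by (simp add: ennreal_le_iff)
    hence "sqrt ?D \<le> sqrt (?I * ?r\<^sup>2)"
      using r by (simp add: pos_divide_le_eq)
    hence "sqrt ?D \<le> sqrt ?I * ?r"
      using r by (simp add: real_sqrt_mult)
    moreover have "0 \<le> ip_norm ip f"
      using ip_self_nonneg[OF f] by (simp add: ip_norm_def)
    ultimately have "ip_norm ip f * sqrt ?D \<le> ip_norm ip f * (sqrt ?I * ?r)"
      by (rule mult_left_mono)
    hence "dist (f \<alpha>) (f \<beta>) \<le> ip_norm ip f * sqrt ?I * ?r"
      using cmod_diff_le[OF f \<alpha>\<beta>(1,2)] by (simp add: dist_norm mult.assoc)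
    thus "ennreal (dist (f \<alpha>) (f \<beta>)) / ennreal ?r \<le> ennreal (ip_norm ip f * sqrt ?I)"
      using r by (subst divide_ennreal) (auto intro!: ennreal_leI simp: pos_divide_le_eq)
  qed
  moreover have "antimono_on {0<..} (heat_Lip_integral A w)"
    using heat_Lip_integral_antimono[OF energy] by (rule monotone_on_subset) simp
  ultimately show ?thesis
    using fin by blast
qed

end
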